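(* Consider the single-armed bandit with subsidy described in the context. Suppose $p_{11}\neq p_{01}$ and that the discount factor $\beta\in(0,1)$ satisfies both $$\beta \le \begin{cases}\dfrac{1}{2(p_{11}-p_{01})\left[1+\sum_{i\in P}(p_{i,1}-p_{i,0})\right]}, & p_{11}>p_{01},\\[2ex] \dfrac{1}{(p_{01}-p_{11})\left[3+4\sum_{i\in P}(p_{i,1}-p_{i,0})\right]}, & p_{01}>p_{11},\end{cases}$$ where $P=\{i\in\{1,\dots,K\}: p_{i,1}-p_{i,0}\ge 0\}$, and $0<\beta\le \tfrac12$. Then the restless single-armed bandit is indexable: the passive set $P(m)=\{\omega\in[0,1]: V_{\beta,m}(\omega;a=1)\le V_{\beta,m}(\omega;a=0)\}$ monotonically expands (with respect to set inclusion) from the empty set to the entire state space $[0,1]$ as $m$ increases from $-\infty$ to $+\infty$.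
   Context: A channel (arm) has a hidden state evolving as a two-state Markov chain on $\{0,1\}$, where $p_{01}$ is the probability of moving from $0$ to $1$ and $p_{11}$ that of staying at $1$ in one step. $K\ge1$ is the number of observation (CQI) levels; when the arm is active in state $s\in\{0,1\}$, level $i\in\{1,\dots,K\}$ is observed with probability $p_{i,s}$, where $\sum_{i=1}^K p_{i,0}=\sum_{i=1}^K p_{i,1}=1$. The belief $\omega\in[0,1]$ is the conditional probability that the current state is $1$. If the arm is passive ($a=0$), no observation is made and the next belief is $\mathcal T(\omega)=p_{11}\omega+p_{01}(1-\omega)$. If the arm is active ($a=1$), level $i$ is observed with probability $p_i(\omega)=p_{i,1}\omega+p_{i,0}(1-\omega)$, and the next belief is then $$\omega_i=\frac{p_{11}p_{i,1}\omega+p_{01}p_{i,0}(1-\omega)}{p_{i,1}\omega+p_{i,0}(1-\omega)}$$ (terms with $p_i(\omega)=0$ are read as $0$ in sums weighted by $p_i(\omega)$). The expected immediate reward is $\omega$ if active and the subsidy $m\in\mathbb R$ if passive. $V_{\beta,m}(\omega)$ is the maximal expected total $\beta$-discounted reward over the infinite horizon from initial belief $\omega$, over policies choosing actions as functions of the belief. It satisfies $V_{\beta,m}(\omega)=\max\{V_{\beta,m}(\omega;a=0),V_{\beta,m}(\omega;a=1)\}$ with $$V_{\beta,m}(\omega;a=0)=m+\beta V_{\beta,m}(\mathcal T(\omega)),\qquad V_{\beta,m}(\omega;a=1)=\omega+\beta\sum_{i=1}^K p_i(\omega)V_{\beta,m}(\omega_i).$$ *)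

theory Defs
  imports "HOL-Probability.Probability_Mass_Function"
begin

datatype action = Passive | Active

text \<open>
  \<open>p i s\<close> is the probability of observing level \<open>i\<close> when the active arm is in state \<open>s \<in> {0, 1}\<close>.
  Beliefs are real numbers; only those in \<open>{0..1}\<close> are meaningful.
\<close>

locale cqi_arm =
  fixes p01 p11 :: real
    and K :: nat
    and p :: "nat \<Rightarrow> nat \<Rightarrow> real"
  assumes p01_range: "0 \<le> p01" "p01 \<le> 1"
    and p11_range: "0 \<le> p11" "p11 \<le> 1"
    and K_ge_1: "1 \<le> K"
    and p_nonneg: "\<And>i s. i \<in> {1..K} \<Longrightarrow> s \<in> {0, 1} \<Longrightarrow> 0 \<le> p i s"
    and p_sum: "(\<Sum>i = 1..K. p i 0) = 1" "(\<Sum>i = 1..K. p i 1) = 1"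
begin

definition passive_update :: "real \<Rightarrow> real" where
  "passive_update \<omega> = p11 * \<omega> + p01 * (1 - \<omega>)"

definition level_prob :: "nat \<Rightarrow> real \<Rightarrow> real" where
  "level_prob i \<omega> = p i 1 * \<omega> + p i 0 * (1 - \<omega>)"

text \<open>If \<open>level_prob i \<omega> = 0\<close>, the value is \<open>0\<close> by the convention for division; it then always
  carries weight \<open>0\<close>.\<close>

definition active_update :: "nat \<Rightarrow> real \<Rightarrow> real" where
  "active_update i \<omega> =
     (p11 * p i 1 * \<omega> + p01 * p i 0 * (1 - \<omega>)) / (p i 1 * \<omega> + p i 0 * (1 - \<omega>))"

definition level_pmf :: "real \<Rightarrow> nat pmf" where
  "level_pmf \<omega> = embed_pmf (\<lambda>i. if i \<in> {1..K} then level_prob i \<omega> else 0)"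

lemma pmf_level_pmf:
  assumes "\<omega> \<in> {0..1}"
  shows "pmf (level_pmf \<omega>) i = (if i \<in> {1..K} then level_prob i \<omega> else 0)"
proof -
  let ?f = "\<lambda>i. if i \<in> {1..K} then level_prob i \<omega> else 0"
  have nonneg: "0 \<le> ?f i" for i
    using assms p_nonneg[of i] by (auto simp: level_prob_def)
  have "(\<Sum>i = 1..K. level_prob i \<omega>) = (\<Sum>i = 1..K. p i 1) * \<omega> + (\<Sum>i = 1..K. p i 0) * (1 - \<omega>)"
    by (simp only: level_prob_def sum.distrib sum_distrib_right)
  then have total: "(\<Sum>i = 1..K. ?f i) = 1"
    using p_sum by simp
  have "(\<integral>\<^sup>+ i. ennreal (?f i) \<partial>count_space UNIV) = (\<Sum>i = 1..K. ennreal (?f i))"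
    by (rule nn_integral_count_space'[where A = "{1..K}"]) auto
  also have "\<dots> = ennreal (\<Sum>i = 1..K. ?f i)"
    by (rule sum_ennreal) (rule nonneg)
  finally show ?thesis
    unfolding level_pmf_def using nonneg total by (subst pmf_embed_pmf) auto
qed

fun next_belief :: "action \<Rightarrow> real \<Rightarrow> real pmf" where
  "next_belief Passive \<omega> = return_pmf (passive_update \<omega>)"
| "next_belief Active \<omega> = map_pmf (\<lambda>i. active_update i \<omega>) (level_pmf \<omega>)"

text \<open>A policy \<open>\<pi>\<close> chooses the action \<open>\<pi> t \<omega>\<close> in slot \<open>t\<close> when the belief in that slot is \<open>\<omega>\<close>.
  The following is the distribution of the belief in slot \<open>t\<close>, starting from \<open>\<omega>\<close> in slot \<open>0\<close>.\<close>

primrec belief_pmf :: "(nat \<Rightarrow> real \<Rightarrow> action) \<Rightarrow> real \<Rightarrow> nat \<Rightarrow> real pmf" where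
  "belief_pmf \<pi> \<omega> 0 = return_pmf \<omega>"
| "belief_pmf \<pi> \<omega> (Suc t) = bind_pmf (belief_pmf \<pi> \<omega> t) (\<lambda>x. next_belief (\<pi> t x) x)"

fun reward :: "real \<Rightarrow> action \<Rightarrow> real \<Rightarrow> real" where
  "reward m Passive \<omega> = m"
| "reward m Active \<omega> = \<omega>"

definition policy_value :: "real \<Rightarrow> real \<Rightarrow> (nat \<Rightarrow> real \<Rightarrow> action) \<Rightarrow> real \<Rightarrow> real" where
  "policy_value \<beta> m \<pi> \<omega> =
     (\<Sum>t. \<beta> ^ t * measure_pmf.expectation (belief_pmf \<pi> \<omega> t) (\<lambda>x. reward m (\<pi> t x) x))"

definition V :: "real \<Rightarrow> real \<Rightarrow> real \<Rightarrow> real" where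
  "V \<beta> m \<omega> = (SUP \<pi>. policy_value \<beta> m \<pi> \<omega>)"

fun V_action :: "real \<Rightarrow> real \<Rightarrow> real \<Rightarrow> action \<Rightarrow> real" where
  "V_action \<beta> m \<omega> Passive = m + \<beta> * V \<beta> m (passive_update \<omega>)"
| "V_action \<beta> m \<omega> Active =
     \<omega> + \<beta> * (\<Sum>i = 1..K. level_prob i \<omega> * V \<beta> m (active_update i \<omega>))"

definition passive_set :: "real \<Rightarrow> real \<Rightarrow> real set" where
  "passive_set \<beta> m = {\<omega> \<in> {0..1}. V_action \<beta> m \<omega> Active \<le> V_action \<beta> m \<omega> Passive}"

text \<open>The passive set is empty for all sufficiently small subsidies and is the whole belief space
  for all sufficiently large ones.\<close>

definition indexable :: "real \<Rightarrow> bool" where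
  "indexable \<beta> \<longleftrightarrow>
     mono (passive_set \<beta>) \<and>
     (\<forall>\<^sub>F m in at_bot. passive_set \<beta> m = {}) \<and>
     (\<forall>\<^sub>F m in at_top. passive_set \<beta> m = {0..1})"

end

end

theory Submission
  imports Defs
begin

text \<open>
  Indexability follows from how fast the value function can grow with the subsidy. The law of the belief process under a fixed policy
  does not involve the subsidy. Raising the subsidy from \<open>m\<close> to \<open>m'\<close> therefore raises
  the reward of every slot by either \<open>0\<close> or \<open>m' - m\<close>, hence the value of every policy, and then
  also the supremum \<open>V\<close>, by an amount between \<open>0\<close> and \<open>(m' - m) / (1 - \<beta>)\<close> (lemmas
  \<open>V_mono_subsidy\<close> and \<open>V_subsidy_growth\<close>).

  The value of acting passively now gains at least \<open>m' - m\<close>. The value of acting actively now is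
  affected only through the continuation, a convex combination of values of \<open>V\<close> discounted by \<open>\<beta>\<close>,
  so it gains at most \<open>\<beta> (m' - m) / (1 - \<beta>)\<close>. For \<open>\<beta> \<le> 1/2\<close> this is no more than \<open>m' - m\<close>, so the
  advantage of the passive action is nondecreasing in the subsidy at every belief, and the passive
  set expands.

  For the two extremes it suffices to compare with constant policies. Being active forever is worth
  at least \<open>0\<close>, which beats a sufficiently negative subsidy now followed by anything; being passive
  forever is worth \<open>m / (1 - \<beta>)\<close>, which is optimal once \<open>m \<ge> 1\<close>.
\<close>

context cqi_arm
begin

section \<open>The belief process\<close>

lemma level_prob_nonneg:
  assumes "\<omega> \<in> {0..1}" "i \<in> {1..K}"
  shows "0 \<le> level_prob i \<omega>"
  using assms p_nonneg[of i] by (auto simp: level_prob_def)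

lemma sum_level_prob: "(\<Sum>i = 1..K. level_prob i \<omega>) = 1"
proof -
  have "(\<Sum>i = 1..K. level_prob i \<omega>) = (\<Sum>i = 1..K. p i 1) * \<omega> + (\<Sum>i = 1..K. p i 0) * (1 - \<omega>)"
    by (simp only: level_prob_def sum.distrib sum_distrib_right)
  then show ?thesis
    using p_sum by simp
qed

lemma passive_update_in_unit:
  assumes "\<omega> \<in> {0..1}"
  shows "passive_update \<omega> \<in> {0..1}"
proof -
  have "p11 * \<omega> \<le> 1 * \<omega>" "p01 * (1 - \<omega>) \<le> 1 * (1 - \<omega>)"
    using assms p01_range p11_range by (intro mult_right_mono; simp)+
  then show ?thesis
    using assms p01_range p11_range by (simp add: passive_update_def)
qed

lemma active_update_in_unit:
  assumes "\<omega> \<in> {0..1}" "i \<in> {1..K}"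
  shows "active_update i \<omega> \<in> {0..1}"
proof -
  let ?a = "p i 1 * \<omega>" and ?b = "p i 0 * (1 - \<omega>)"
  have nonneg: "0 \<le> ?a" "0 \<le> ?b"
    using assms p_nonneg[of i] by auto
  have "p11 * ?a \<le> 1 * ?a" "p01 * ?b \<le> 1 * ?b"
    using nonneg p01_range p11_range by (intro mult_right_mono; simp)+
  moreover have "0 \<le> p11 * ?a" "0 \<le> p01 * ?b"
    using nonneg p01_range p11_range by simp_all
  ultimately show ?thesis
    using nonneg unfolding active_update_def by (auto simp: divide_le_eq_1 mult.assoc)
qed

text \<open>Rewards are bounded only on \<open>{0..1}\<close>, so integrability of the rewards and convergence of
  their discounted sums rest on the belief never leaving this interval.\<close>

lemma set_belief_pmf:
  assumes "\<omega> \<in> {0..1}"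
  shows "set_pmf (belief_pmf \<pi> \<omega> t) \<subseteq> {0..1}"
proof (induction t)
  case 0
  then show ?case using assms by simp
next
  case (Suc t)
  have "set_pmf (next_belief a x) \<subseteq> {0..1}" if x: "x \<in> {0..1}" for a x
  proof (cases a)
    case Passive
    then show ?thesis using passive_update_in_unit[OF x] by simp
  next
    case Active
    have "i \<in> {1..K}" if "i \<in> set_pmf (level_pmf x)" for i
      using that pmf_level_pmf[OF x, of i] by (metis set_pmf_iff)
    then have "(\<lambda>i. active_update i x) ` set_pmf (level_pmf x) \<subseteq> {0..1}"
      by (intro image_subsetI active_update_in_unit[OF x])
    then show ?thesis
      unfolding Active by (simp only: next_belief.simps set_map_pmf)
  qed
  then have "(\<Union>x\<in>set_pmf (belief_pmf \<pi> \<omega> t). set_pmf (next_belief (\<pi> t x) x)) \<subseteq> {0..1}"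
    using Suc by blast
  then show ?case
    by (simp only: belief_pmf.simps set_bind_pmf)
qed

section \<open>Comparing discounted rewards\<close>

text \<open>
  Policy values under different subsidies, and the values \<open>c / (1 - \<beta>)\<close> of constant reward streams,
  are all discounted sums along the same belief process; the following lemma compares them by
  comparing the rewards slot by slot.
\<close>

definition discounted_sum :: "real \<Rightarrow> (nat \<Rightarrow> real \<Rightarrow> action) \<Rightarrow> real \<Rightarrow> (nat \<Rightarrow> real \<Rightarrow> real) \<Rightarrow> real"
  where "discounted_sum \<beta> \<pi> \<omega> f = (\<Sum>t. \<beta> ^ t * measure_pmf.expectation (belief_pmf \<pi> \<omega> t) (f t))"

lemma policy_value_eq_discounted_sum:
  "policy_value \<beta> m \<pi> \<omega> = discounted_sum \<beta> \<pi> \<omega> (\<lambda>t x. reward m (\<pi> t x) x)"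
  by (simp add: policy_value_def discounted_sum_def)

lemma discounted_sum_zero: "discounted_sum \<beta> \<pi> \<omega> (\<lambda>t x. 0) = 0"
  by (simp add: discounted_sum_def)

lemma discounted_sum_le_add_const:
  assumes \<beta>: "0 < \<beta>" "\<beta> < 1" and \<omega>: "\<omega> \<in> {0..1}"
    and f: "\<And>t x. x \<in> {0..1} \<Longrightarrow> \<bar>f t x\<bar> \<le> B"
    and g: "\<And>t x. x \<in> {0..1} \<Longrightarrow> \<bar>g t x\<bar> \<le> C"
    and le: "\<And>t x. x \<in> {0..1} \<Longrightarrow> f t x \<le> g t x + c"
  shows "discounted_sum \<beta> \<pi> \<omega> f \<le> discounted_sum \<beta> \<pi> \<omega> g + c / (1 - \<beta>)"
proof -
  let ?E = "\<lambda>h t. measure_pmf.expectation (belief_pmf \<pi> \<omega> t) (h t)"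
  have ae: "AE x in measure_pmf (belief_pmf \<pi> \<omega> t). Q x" if "\<And>x. x \<in> {0..1} \<Longrightarrow> Q x" for t Q
    using set_belief_pmf[OF \<omega>, of \<pi> t] that by (intro AE_pmfI) blast
  have integrable: "integrable (measure_pmf (belief_pmf \<pi> \<omega> t)) (h t)"
    if "\<And>t x. x \<in> {0..1} \<Longrightarrow> \<bar>h t x\<bar> \<le> D" for h :: "nat \<Rightarrow> real \<Rightarrow> real" and D t
    using that by (intro measure_pmf.integrable_const_bound[where B = D] ae) simp_all
  have summable: "summable (\<lambda>t. \<beta> ^ t * ?E h t)"
    if D: "\<And>t x. x \<in> {0..1} \<Longrightarrow> \<bar>h t x\<bar> \<le> D" for h :: "nat \<Rightarrow> real \<Rightarrow> real" and D
  proof (rule summable_comparison_test')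
    show "summable (\<lambda>t. D * \<beta> ^ t)"
      using \<beta> by (intro summable_mult summable_geometric) simp
    show "norm (\<beta> ^ t * ?E h t) \<le> D * \<beta> ^ t" if "t \<ge> 0" for t
    proof -
      have "\<bar>?E h t\<bar> \<le> ?E (\<lambda>t x. \<bar>h t x\<bar>) t"
        by (rule integral_abs_bound)
      also have "\<dots> \<le> D"
        using integrable[of h D t, OF D] D
        by (intro measure_pmf.integral_le_const ae integrable_abs)
      finally show ?thesis
        using \<beta> by (simp add: abs_mult mult.commute mult_right_mono)
    qed
  qed
  have E_le: "?E f t \<le> ?E g t + c" for t
  proof -
    have "?E f t \<le> ?E (\<lambda>t x. g t x + c) t"
      using integrable[of f B t, OF f] integrable[of g C t, OF g] le
      by (intro integral_mono_AE ae) simp_all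
    also have "\<dots> = ?E g t + c"
      using integrable[of g C t, OF g] by simp
    finally show ?thesis .
  qed
  have geometric: "(\<lambda>t. c * \<beta> ^ t) sums (c / (1 - \<beta>))"
    using sums_mult[OF geometric_sums, of \<beta> c] \<beta> by simp
  have "discounted_sum \<beta> \<pi> \<omega> f \<le> (\<Sum>t. \<beta> ^ t * ?E g t + c * \<beta> ^ t)"
    unfolding discounted_sum_def
  proof (rule suminf_le)
    show "\<beta> ^ t * ?E f t \<le> \<beta> ^ t * ?E g t + c * \<beta> ^ t" for t
      using mult_left_mono[OF E_le[of t], of "\<beta> ^ t"] \<beta> by (simp add: algebra_simps)
    show "summable (\<lambda>t. \<beta> ^ t * ?E f t)"
      by (rule summable[OF f])
    show "summable (\<lambda>t. \<beta> ^ t * ?E g t + c * \<beta> ^ t)"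
      using summable[of g C, OF g] geometric by (intro summable_add) (auto dest: sums_summable)
  qed
  also have "\<dots> = discounted_sum \<beta> \<pi> \<omega> g + c / (1 - \<beta>)"
    unfolding discounted_sum_def
    using suminf_add[OF summable[of g C, OF g] sums_summable[OF geometric]] sums_unique[OF geometric]
    by simp
  finally show ?thesis .
qed

section \<open>Dependence of the value function on the subsidy\<close>

lemma abs_reward_le:
  assumes "x \<in> {0..1}"
  shows "\<bar>reward m a x\<bar> \<le> max 1 \<bar>m\<bar>"
  using assms by (cases a) auto

lemma policy_value_le:
  assumes "0 < \<beta>" "\<beta> < 1" "\<omega> \<in> {0..1}"
    and "\<And>t x. x \<in> {0..1} \<Longrightarrow> reward m (\<pi> t x) x \<le> c"
  shows "policy_value \<beta> m \<pi> \<omega> \<le> c / (1 - \<beta>)"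
proof -
  have "discounted_sum \<beta> \<pi> \<omega> (\<lambda>t x. reward m (\<pi> t x) x)
      \<le> discounted_sum \<beta> \<pi> \<omega> (\<lambda>t x. 0) + c / (1 - \<beta>)"
    by (rule discounted_sum_le_add_const[OF assms(1-3), where B = "max 1 \<bar>m\<bar>" and C = 0])
      (use assms(4) abs_reward_le in auto)
  then show ?thesis
    by (simp add: policy_value_eq_discounted_sum discounted_sum_zero)
qed

lemma policy_value_ge:
  assumes "0 < \<beta>" "\<beta> < 1" "\<omega> \<in> {0..1}"
    and "\<And>t x. x \<in> {0..1} \<Longrightarrow> c \<le> reward m (\<pi> t x) x"
  shows "c / (1 - \<beta>) \<le> policy_value \<beta> m \<pi> \<omega>"
proof -
  have "discounted_sum \<beta> \<pi> \<omega> (\<lambda>t x. 0)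
      \<le> discounted_sum \<beta> \<pi> \<omega> (\<lambda>t x. reward m (\<pi> t x) x) + (- c) / (1 - \<beta>)"
    by (rule discounted_sum_le_add_const[OF assms(1-3), where B = 0 and C = "max 1 \<bar>m\<bar>"])
      (use assms(4) abs_reward_le in auto)
  then show ?thesis
    by (simp add: policy_value_eq_discounted_sum discounted_sum_zero)
qed

lemma policy_value_diff_le:
  assumes "0 < \<beta>" "\<beta> < 1" "\<omega> \<in> {0..1}"
    and "\<And>t x. x \<in> {0..1} \<Longrightarrow> reward m (\<pi> t x) x \<le> reward m' (\<pi> t x) x + c"
  shows "policy_value \<beta> m \<pi> \<omega> \<le> policy_value \<beta> m' \<pi> \<omega> + c / (1 - \<beta>)"
  unfolding policy_value_eq_discounted_sum
  by (rule discounted_sum_le_add_const[OF assms(1-3), where B = "max 1 \<bar>m\<bar>" and C = "max 1 \<bar>m'\<bar>"])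
    (use assms(4) in \<open>simp_all only: abs_reward_le\<close>)

lemma reward_le_max: "x \<in> {0..1} \<Longrightarrow> reward m a x \<le> max 1 m"
  by (cases a) auto

lemma policy_value_le_V:
  assumes "0 < \<beta>" "\<beta> < 1" "\<omega> \<in> {0..1}"
  shows "policy_value \<beta> m \<pi> \<omega> \<le> V \<beta> m \<omega>"
  unfolding V_def
proof (rule cSUP_upper)
  show "bdd_above (range (\<lambda>\<pi>. policy_value \<beta> m \<pi> \<omega>))"
    using policy_value_le[OF assms reward_le_max] by (intro bdd_aboveI2)
qed simp

lemma V_le:
  assumes "0 < \<beta>" "\<beta> < 1" "\<omega> \<in> {0..1}"
  shows "V \<beta> m \<omega> \<le> max 1 m / (1 - \<beta>)"
  unfolding V_def using policy_value_le[OF assms reward_le_max] by (intro cSUP_least) auto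

lemma V_nonneg:
  assumes "0 < \<beta>" "\<beta> < 1" "\<omega> \<in> {0..1}"
  shows "0 \<le> V \<beta> m \<omega>"
  using policy_value_ge[OF assms, of 0 m "\<lambda>_ _. Active"] policy_value_le_V[OF assms, of m "\<lambda>_ _. Active"]
  by simp

lemma V_ge_always_passive:
  assumes "0 < \<beta>" "\<beta> < 1" "\<omega> \<in> {0..1}"
  shows "m / (1 - \<beta>) \<le> V \<beta> m \<omega>"
  using policy_value_ge[OF assms, of m m "\<lambda>_ _. Passive"] policy_value_le_V[OF assms, of m "\<lambda>_ _. Passive"]
  by simp

text \<open>A slotwise bound that is uniform in the action holds for every policy with the same
  constant, hence survives the supremum over policies.\<close>

lemma V_diff_le:
  assumes "0 < \<beta>" "\<beta> < 1" "\<omega> \<in> {0..1}"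
    and "\<And>a x. x \<in> {0..1} \<Longrightarrow> reward m a x \<le> reward m' a x + c"
  shows "V \<beta> m \<omega> \<le> V \<beta> m' \<omega> + c / (1 - \<beta>)"
proof -
  have "policy_value \<beta> m \<pi> \<omega> \<le> V \<beta> m' \<omega> + c / (1 - \<beta>)" for \<pi>
  proof -
    have "policy_value \<beta> m \<pi> \<omega> \<le> policy_value \<beta> m' \<pi> \<omega> + c / (1 - \<beta>)"
      using assms by (rule policy_value_diff_le)
    also have "policy_value \<beta> m' \<pi> \<omega> \<le> V \<beta> m' \<omega>"
      using assms(1-3) by (rule policy_value_le_V)
    finally show ?thesis by simp
  qed
  then show ?thesis
    unfolding V_def[of \<beta> m] by (intro cSUP_least) auto
qed

lemma V_mono_subsidy:
  assumes "0 < \<beta>" "\<beta> < 1" "\<omega> \<in> {0..1}" "m \<le> m'"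
  shows "V \<beta> m \<omega> \<le> V \<beta> m' \<omega>"
proof -
  have "reward m a x \<le> reward m' a x + 0" for a x
    using assms(4) by (cases a) auto
  from V_diff_le[OF assms(1-3) this] show ?thesis by simp
qed

lemma V_subsidy_growth:
  assumes "0 < \<beta>" "\<beta> < 1" "\<omega> \<in> {0..1}" "m \<le> m'"
  shows "V \<beta> m' \<omega> \<le> V \<beta> m \<omega> + (m' - m) / (1 - \<beta>)"
proof -
  have "reward m' a x \<le> reward m a x + (m' - m)" for a x
    using assms(4) by (cases a) auto
  from V_diff_le[OF assms(1-3) this] show ?thesis .
qed

section \<open>Monotonicity and limits of the passive set\<close>

text \<open>The next beliefs are averaged with weights of total mass \<open>1\<close>, so a uniform bound passes to
  the average.\<close>

lemma level_average_le:
  assumes "\<omega> \<in> {0..1}" and "\<And>i. i \<in> {1..K} \<Longrightarrow> F i \<le> G i + c"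
  shows "(\<Sum>i = 1..K. level_prob i \<omega> * F i) \<le> (\<Sum>i = 1..K. level_prob i \<omega> * G i) + c"
proof -
  have "(\<Sum>i = 1..K. level_prob i \<omega> * F i) \<le> (\<Sum>i = 1..K. level_prob i \<omega> * (G i + c))"
    using assms level_prob_nonneg by (intro sum_mono mult_left_mono) auto
  also have "\<dots> = (\<Sum>i = 1..K. level_prob i \<omega> * G i) + (\<Sum>i = 1..K. level_prob i \<omega>) * c"
    by (simp only: distrib_left sum.distrib sum_distrib_right)
  finally show ?thesis by (simp only: sum_level_prob mult_1)
qed

lemma V_action_Passive_growth:
  assumes "0 < \<beta>" "\<beta> < 1" "\<omega> \<in> {0..1}" "m \<le> m'"
  shows "V_action \<beta> m \<omega> Passive + (m' - m) \<le> V_action \<beta> m' \<omega> Passive"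
  using V_mono_subsidy[OF assms(1,2) passive_update_in_unit[OF assms(3)] assms(4)] assms(1) by simp

lemma V_action_Active_growth:
  assumes "0 < \<beta>" "\<beta> < 1" "\<omega> \<in> {0..1}" "m \<le> m'"
  shows "V_action \<beta> m' \<omega> Active \<le> V_action \<beta> m \<omega> Active + \<beta> * (m' - m) / (1 - \<beta>)"
proof -
  have "(\<Sum>i = 1..K. level_prob i \<omega> * V \<beta> m' (active_update i \<omega>))
      \<le> (\<Sum>i = 1..K. level_prob i \<omega> * V \<beta> m (active_update i \<omega>)) + (m' - m) / (1 - \<beta>)"
    using V_subsidy_growth[OF assms(1,2) active_update_in_unit[OF assms(3)] assms(4)]
    by (intro level_average_le[OF assms(3)])
  from mult_left_mono[OF this, of \<beta>] show ?thesis
    using assms(1) by (simp add: distrib_left)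
qed

text \<open>The bound \<open>\<beta> \<le> 1/2\<close> says precisely that \<open>\<beta> / (1 - \<beta>) \<le> 1\<close>: the extra subsidies
  collected over the whole future, starting one slot later, are worth at most one extra subsidy
  now.\<close>

lemma passive_set_mono:
  assumes "0 < \<beta>" "\<beta> \<le> 1 / 2"
  shows "mono (passive_set \<beta>)"
proof (rule monoI)
  fix m m' :: real
  assume "m \<le> m'"
  have "\<beta> * (m' - m) / (1 - \<beta>) \<le> m' - m"
  proof -
    have "\<beta> / (1 - \<beta>) \<le> 1"
      using assms by simp
    from mult_right_mono[OF this, of "m' - m"] show ?thesis
      using \<open>m \<le> m'\<close> by simp
  qed
  moreover have "\<beta> < 1"
    using assms(2) by simp
  ultimately have "V_action \<beta> m' \<omega> Active \<le> V_action \<beta> m' \<omega> Passive"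
    if "\<omega> \<in> {0..1}" "V_action \<beta> m \<omega> Active \<le> V_action \<beta> m \<omega> Passive" for \<omega>
    using V_action_Passive_growth[OF assms(1) \<open>\<beta> < 1\<close> that(1) \<open>m \<le> m'\<close>]
      V_action_Active_growth[OF assms(1) \<open>\<beta> < 1\<close> that(1) \<open>m \<le> m'\<close>] that(2) by linarith
  then show "passive_set \<beta> m \<subseteq> passive_set \<beta> m'"
    unfolding passive_set_def by blast
qed

text \<open>For a negative subsidy every reward is at most \<open>1\<close>, so the continuation after a passive slot
  is worth at most \<open>\<beta> / (1 - \<beta>)\<close>; the threshold makes this too little to repay the subsidy, while
  acting actively has nonnegative value.\<close>

lemma passive_set_empty:
  assumes "0 < \<beta>" "\<beta> < 1" "m < - (\<beta> / (1 - \<beta>))"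
  shows "passive_set \<beta> m = {}"
proof -
  have "0 < \<beta> / (1 - \<beta>)"
    using assms by simp
  then have max: "max 1 m = 1"
    using assms(3) by simp
  have "V_action \<beta> m \<omega> Passive < V_action \<beta> m \<omega> Active" if \<omega>: "\<omega> \<in> {0..1}" for \<omega>
  proof -
    have "\<beta> * V \<beta> m (passive_update \<omega>) \<le> \<beta> * (1 / (1 - \<beta>))"
      using V_le[OF assms(1,2) passive_update_in_unit[OF \<omega>], of m] assms(1) max
      by (intro mult_left_mono) auto
    then have "V_action \<beta> m \<omega> Passive < 0"
      using assms(3) by simp
    also have "0 \<le> V_action \<beta> m \<omega> Active"
      using \<omega> assms(1,2) level_prob_nonneg[OF \<omega>] V_nonneg active_update_in_unit[OF \<omega>]
      by (auto intro!: add_nonneg_nonneg mult_nonneg_nonneg sum_nonneg)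
    finally show ?thesis .
  qed
  then show ?thesis
    unfolding passive_set_def using not_le by blast
qed

text \<open>For \<open>m \<ge> 1\<close> no reward exceeds the subsidy, so \<open>V\<close> equals \<open>m / (1 - \<beta>)\<close> at every belief.
  The two actions then have equal continuations and only the immediate rewards \<open>\<omega> \<le> 1 \<le> m\<close>
  matter.\<close>

lemma passive_set_full:
  assumes "0 < \<beta>" "\<beta> < 1" "1 \<le> m"
  shows "passive_set \<beta> m = {0..1}"
proof -
  have "V_action \<beta> m \<omega> Active \<le> V_action \<beta> m \<omega> Passive" if \<omega>: "\<omega> \<in> {0..1}" for \<omega>
  proof -
    have "V \<beta> m (active_update i \<omega>) \<le> V \<beta> m (passive_update \<omega>) + 0" if "i \<in> {1..K}" for i
      using V_le[OF assms(1,2) active_update_in_unit[OF \<omega> that], of m]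
        V_ge_always_passive[OF assms(1,2) passive_update_in_unit[OF \<omega>], of m] assms(3)
      by (simp add: max_def split: if_splits)
    then have "(\<Sum>i = 1..K. level_prob i \<omega> * V \<beta> m (active_update i \<omega>))
        \<le> (\<Sum>i = 1..K. level_prob i \<omega> * V \<beta> m (passive_update \<omega>)) + 0"
      by (rule level_average_le[OF \<omega>])
    also have "\<dots> = V \<beta> m (passive_update \<omega>)"
      by (simp only: sum_distrib_right[symmetric] sum_level_prob mult_1 add_0_right)
    finally have "(\<Sum>i = 1..K. level_prob i \<omega> * V \<beta> m (active_update i \<omega>)) \<le> V \<beta> m (passive_update \<omega>)" .
    from mult_left_mono[OF this, of \<beta>] have
      "\<beta> * (\<Sum>i = 1..K. level_prob i \<omega> * V \<beta> m (active_update i \<omega>)) \<le> \<beta> * V \<beta> m (passive_update \<omega>)"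
      using assms(1) by simp
    moreover have "\<omega> \<le> m"
      using \<omega> assms(3) by simp
    ultimately show ?thesis
      unfolding V_action.simps by linarith
  qed
  then show ?thesis
    unfolding passive_set_def by blast
qed

lemma indexable_if_discount_le_half:
  assumes "0 < \<beta>" "\<beta> \<le> 1 / 2"
  shows "indexable \<beta>"
  unfolding indexable_def
proof (intro conjI)
  have "\<beta> < 1"
    using assms(2) by simp
  show "mono (passive_set \<beta>)"
    using assms by (rule passive_set_mono)
  show "\<forall>\<^sub>F m in at_bot. passive_set \<beta> m = {}"
    using eventually_gt_at_bot[of "- (\<beta> / (1 - \<beta>))"]
    by eventually_elim (rule passive_set_empty[OF assms(1) \<open>\<beta> < 1\<close>])
  show "\<forall>\<^sub>F m in at_top. passive_set \<beta> m = {0..1}"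
    using eventually_ge_at_top[of 1]
    by eventually_elim (rule passive_set_full[OF assms(1) \<open>\<beta> < 1\<close>])
qed

end

theorem corollary1:
  fixes p01 p11 \<beta> :: real and K :: nat and p :: "nat \<Rightarrow> nat \<Rightarrow> real"
  assumes "cqi_arm p01 p11 K p"
    and "p11 \<noteq> p01"
    and "0 < \<beta>" and "\<beta> < 1"
    and "p11 > p01 \<Longrightarrow>
      \<beta> \<le> 1 / (2 * (p11 - p01) * (1 + (\<Sum>i \<in> {i \<in> {1..K}. p i 1 - p i 0 \<ge> 0}. p i 1 - p i 0)))"
    and "p01 > p11 \<Longrightarrow>
      \<beta> \<le> 1 / ((p01 - p11) * (3 + 4 * (\<Sum>i \<in> {i \<in> {1..K}. p i 1 - p i 0 \<ge> 0}. p i 1 - p i 0)))"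
    and "\<beta> \<le> 1 / 2"
  shows "cqi_arm.indexable p01 p11 K p \<beta>"
  using assms(1,3,7) by (rule cqi_arm.indexable_if_discount_le_half)

end
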